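(* Let $m\ge2$, let $H\le\mathrm{Sym}(m)$ be transitive, let $K\le W_H$ be a closed branch subgroup, and let $G_K=\langle H, D_m(K)\rangle\le W_H$. Then $H$ is normal in $G_K$ and the quotient map gives $\pi_H:G_K\to G_K/H\cong D_m(K)$. For any vertex $v$ of level 1, the composition of $\pi_H$ with the projection $\varphi_v:D_m(K)\to K$, $\varphi_v(g)=g|_v$, is a homomorphism $G_K\to K\le \mathrm{Aut}\,T$ with image $K$ and kernel $H$; thus it defines an action of $G_K$ on $T$ by a branch group. Moreover $Z(G_K)\cong Z(H)$, and if $H$ is not abelian then the kernel $H$ of this action is not contained in the center of $G_K$.
   Context: Let $T$ be the $m$-adic rooted tree, identified with the free monoid on $\{1,\dots,m\}$ (vertices are finite words, level $n$ is the set $\mathcal{L}_n$ of words of length $n$). $\mathrm{Aut}\,T$ is the group of automorphisms of the rooted tree $T$ (acting on the right), a profinite group whose topology has the level stabilizers as a base of neighbourhoods of $1$; "closed" refers to this topology. For $g\in\mathrm{Aut}\,T$ and a vertex $v$, the section $g|_v\in\mathrm{Aut}\,T$ is defined by $(vu)^g=v^g u^{g|_v}$ for all $u\in T$; $g|_v^1\in\mathrm{Sym}(m)$ denotes the permutation of $\{1,\dots,m\}$ induced by $g|_v$ on level 1. The iterated wreath product is $W_H=\{g\in\mathrm{Aut}\,T : g|_v^1\in H \text{ for all } v\in T\}$. $H$ is viewed as a subgroup of $W_H$ via rooted automorphisms: $h\in H$ corresponds to the $g$ with $g|_\emptyset^1=h$ and $g|_v^1=1$ for all $v\ne\emptyset$.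 Let $\psi$ be the monomorphism from the stabilizer of level 1 in $\mathrm{Aut}\,T$ to $\mathrm{Aut}\,T\times\overset{m}{\cdots}\times\mathrm{Aut}\,T$ given by $g\mapsto(g|_1,\dots,g|_m)$. For $K\le W_H$, $D_m(K)\le W_H$ is the preimage under $\psi$ of the diagonal embedding $\{(k,\dots,k):k\in K\}$ of $K$. For $G\le\mathrm{Aut}\,T$, the rigid vertex stabilizer $\mathrm{rist}_G(v)$ is the subgroup of elements of $G$ fixing $v$ and every vertex not in the subtree rooted at $v$; $\mathrm{Rist}_G(n)$ is the (direct) product of the $\mathrm{rist}_G(v)$ over $v\in\mathcal{L}_n$. $G$ is branch if it acts transitively on every level of $T$ and $\mathrm{Rist}_G(n)$ has finite index in $G$ for every $n\ge1$. $Z(\cdot)$ denotes the center. *)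

theory Defs
  imports "HOL-Algebra.Sym_Groups" "HOL-Analysis.Abstract_Topology"
begin

definition words :: "nat \<Rightarrow> nat list set"
  where "words m = lists {1..m}"

definition level :: "nat \<Rightarrow> nat \<Rightarrow> nat list set"
  where "level m n = {w \<in> words m. length w = n}"

definition adjacent :: "nat list \<Rightarrow> nat list \<Rightarrow> bool"
  where "adjacent u w \<longleftrightarrow> (\<exists>x. w = u @ [x] \<or> u = w @ [x])"

text \<open>
  Automorphisms are graph automorphisms fixing the root, extended by the identity to lists that are
  not vertices. The action is on the right: the product of \<open>g\<close> and \<open>h\<close> applies \<open>g\<close> first.
\<close>

definition aut_tree :: "nat \<Rightarrow> (nat list \<Rightarrow> nat list) monoid"
  where "aut_tree m =
    \<lparr> carrier = {g. g permutes words m \<and> g [] = [] \<and>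
        (\<forall>u \<in> words m. \<forall>w \<in> words m. adjacent (g u) (g w) \<longleftrightarrow> adjacent u w)},
      mult = (\<lambda>g h. h \<circ> g), one = id \<rparr>"

abbreviation restrict_to :: "'a monoid \<Rightarrow> 'a set \<Rightarrow> 'a monoid"
  where "restrict_to G A \<equiv> G \<lparr>carrier := A\<rparr>"

definition level_stab :: "nat \<Rightarrow> nat \<Rightarrow> (nat list \<Rightarrow> nat list) set"
  where "level_stab m n = {g \<in> carrier (aut_tree m). \<forall>w \<in> level m n. g w = w}"

text \<open>
  The group topology in which the level stabilizers are a base of neighbourhoods of the identity:
  their cosets form a base.
\<close>

definition aut_topology :: "nat \<Rightarrow> (nat list \<Rightarrow> nat list) topology"
  where "aut_topology m = topology_generated_by
    {g <#\<^bsub>aut_tree m\<^esub> level_stab m n | g n. g \<in> carrier (aut_tree m)}"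

text \<open>
  For an automorphism \<open>g\<close> and a vertex \<open>v\<close>, the image of \<open>v @ u\<close> is the image of \<open>v\<close>, a word of
  the same length as \<open>v\<close>, followed by the image of \<open>u\<close> under the section of \<open>g\<close> at \<open>v\<close>.
\<close>

definition tree_section :: "(nat list \<Rightarrow> nat list) \<Rightarrow> nat list \<Rightarrow> nat list \<Rightarrow> nat list"
  where "tree_section g v = (\<lambda>u. drop (length v) (g (v @ u)))"

definition local_perm :: "(nat list \<Rightarrow> nat list) \<Rightarrow> nat list \<Rightarrow> nat \<Rightarrow> nat"
  where "local_perm g v = (\<lambda>x. hd (tree_section g v [x]))"

definition wreath :: "nat \<Rightarrow> (nat \<Rightarrow> nat) set \<Rightarrow> (nat list \<Rightarrow> nat list) set"
  where "wreath m H = {g \<in> carrier (aut_tree m). \<forall>v \<in> words m. local_perm g v \<in> H}"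

definition rooted :: "nat \<Rightarrow> (nat \<Rightarrow> nat) set \<Rightarrow> (nat list \<Rightarrow> nat list) set"
  where "rooted m H = {g \<in> carrier (aut_tree m). local_perm g [] \<in> H \<and>
    (\<forall>v \<in> words m. v \<noteq> [] \<longrightarrow> local_perm g v = id)}"

text \<open>Tuples with \<open>m\<close> entries are functions that are undefined outside \<open>{1..m}\<close>.\<close>

definition psi :: "nat \<Rightarrow> (nat list \<Rightarrow> nat list) \<Rightarrow> nat \<Rightarrow> nat list \<Rightarrow> nat list"
  where "psi m g = (\<lambda>x \<in> {1..m}. tree_section g [x])"

definition diag_subgroup :: "nat \<Rightarrow> (nat list \<Rightarrow> nat list) set \<Rightarrow> (nat list \<Rightarrow> nat list) set"
  where "diag_subgroup m K =
    {g \<in> level_stab m 1. psi m g \<in> (\<lambda>k. \<lambda>x \<in> {1..m}. k) ` K}"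

definition rist :: "nat \<Rightarrow> (nat list \<Rightarrow> nat list) set \<Rightarrow> nat list \<Rightarrow> (nat list \<Rightarrow> nat list) set"
  where "rist m G v = {g \<in> G. g v = v \<and> (\<forall>w \<in> words m. (\<nexists>u. w = v @ u) \<longrightarrow> g w = w)}"

text \<open>
  The internal direct product of the rigid stabilizers of the vertices of one level: these
  commute pairwise, so their product is the subgroup they generate.
\<close>

definition Rist :: "nat \<Rightarrow> (nat list \<Rightarrow> nat list) set \<Rightarrow> nat \<Rightarrow> (nat list \<Rightarrow> nat list) set"
  where "Rist m G n = generate (aut_tree m) (\<Union>v \<in> level m n. rist m G v)"

definition branch :: "nat \<Rightarrow> (nat list \<Rightarrow> nat list) set \<Rightarrow> bool"
  where "branch m G \<longleftrightarrow> subgroup G (aut_tree m) \<and>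
    (\<forall>n. \<forall>u \<in> level m n. \<forall>w \<in> level m n. \<exists>g \<in> G. g u = w) \<and>
    (\<forall>n \<ge> 1. finite (rcosets\<^bsub>restrict_to (aut_tree m) G\<^esub> Rist m G n))"

text \<open>
  The multiplication of \<^const>\<open>sym_group\<close> composes in the order opposite to that of
  \<^const>\<open>aut_tree\<close>; subgroups, centers and commutativity do not depend on this.
\<close>

definition transitive_perms :: "nat \<Rightarrow> (nat \<Rightarrow> nat) set \<Rightarrow> bool"
  where "transitive_perms m H \<longleftrightarrow> (\<forall>x \<in> {1..m}. \<forall>y \<in> {1..m}. \<exists>h \<in> H. h x = y)"

definition center :: "('a, 'b) monoid_scheme \<Rightarrow> 'a set"
  where "center G = {z \<in> carrier G. \<forall>g \<in> carrier G. z \<otimes>\<^bsub>G\<^esub> g = g \<otimes>\<^bsub>G\<^esub> z}"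

definition GK :: "nat \<Rightarrow> (nat \<Rightarrow> nat) set \<Rightarrow> (nat list \<Rightarrow> nat list) set
    \<Rightarrow> (nat list \<Rightarrow> nat list) monoid"
  where "GK m H K =
    restrict_to (aut_tree m) (generate (aut_tree m) (rooted m H \<union> diag_subgroup m K))"

end

(* G_K is the internal direct product of H, acting on the first letter, and D_m(K), acting by one
   and the same k on all subtrees of level 1: the element (h, k) maps x u to h(x) k(u). Everything
   but the center is read off this product. The center is Z(H) x Z(K), and Z(K) = 1: if a central z
   of K moves a vertex v, then by transitivity it moves every vertex w of that level, and a rigid
   element r at w fixes z(w u), hence commutes past z only if it fixes w u. So Rist(n) is trivial
   and K is finite, which is impossible because K is transitive on levels of unbounded size. *)
theory Submission
  imports Defs
begin

section \<open>Tree automorphisms\<close>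

lemma words_simps [simp]:
  "[] \<in> words m" "x # u \<in> words m \<longleftrightarrow> x \<in> {1..m} \<and> u \<in> words m"
  "u @ w \<in> words m \<longleftrightarrow> u \<in> words m \<and> w \<in> words m"
  by (auto simp: words_def)

lemma adjacent_simps [simp]:
  "adjacent (x # u) (y # w) \<longleftrightarrow> x = y \<and> adjacent u w"
  "adjacent [] (y # w) \<longleftrightarrow> w = []"
  "adjacent (x # u) [] \<longleftrightarrow> u = []"
  "\<not> adjacent [] []"
  by (auto simp: adjacent_def)

lemma aut_tree_mult [simp]: "g \<otimes>\<^bsub>aut_tree m\<^esub> h = h \<circ> g"
  and aut_tree_one [simp]: "\<one>\<^bsub>aut_tree m\<^esub> = id"
  by (simp_all add: aut_tree_def)

lemma aut_tree_iff:
  "g \<in> carrier (aut_tree m) \<longleftrightarrow> g permutes words m \<and> g [] = [] \<and>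
    (\<forall>u \<in> words m. \<forall>w \<in> words m. adjacent (g u) (g w) \<longleftrightarrow> adjacent u w)"
  by (simp add: aut_tree_def)

lemma aut_permutes: "g \<in> carrier (aut_tree m) \<Longrightarrow> g permutes words m"
  by (simp add: aut_tree_iff)

lemma aut_Nil [simp]: "g \<in> carrier (aut_tree m) \<Longrightarrow> g [] = []"
  by (simp add: aut_tree_iff)

lemma aut_words [simp]: "g \<in> carrier (aut_tree m) \<Longrightarrow> g w \<in> words m \<longleftrightarrow> w \<in> words m"
  by (simp add: aut_tree_iff permutes_in_image)

lemma aut_outside: "g \<in> carrier (aut_tree m) \<Longrightarrow> w \<notin> words m \<Longrightarrow> g w = w"
  by (rule permutes_not_in[OF aut_permutes])

lemma aut_eq_iff [simp]: "g \<in> carrier (aut_tree m) \<Longrightarrow> g u = g w \<longleftrightarrow> u = w"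
  by (rule inj_eq[OF permutes_inj[OF aut_permutes]])

lemma group_aut_tree: "group (aut_tree m)"
proof (rule groupI)
  fix g assume g: "g \<in> carrier (aut_tree m)"
  note p = aut_permutes[OF g]
  have "inv' g \<in> carrier (aut_tree m)"
    unfolding aut_tree_iff
  proof (intro conjI ballI)
    show "inv' g permutes words m"
      using p by (rule permutes_inv)
    show "inv' g [] = []"
      using g p by (simp add: permutes_inv_eq)
    fix u w assume "u \<in> words m" "w \<in> words m"
    then have "inv' g u \<in> words m" "inv' g w \<in> words m"
      using p permutes_in_image[OF permutes_inv[OF p]] by auto
    then show "adjacent (inv' g u) (inv' g w) \<longleftrightarrow> adjacent u w"
      using g p unfolding aut_tree_iff by (metis permutes_inverses(1))
  qed
  moreover have "g \<circ> inv' g = id"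
    using p by (rule permutes_inv_o)
  ultimately show "\<exists>h \<in> carrier (aut_tree m). h \<otimes>\<^bsub>aut_tree m\<^esub> g = \<one>\<^bsub>aut_tree m\<^esub>"
    by auto
qed (auto simp: aut_tree_iff permutes_compose permutes_id permutes_in_image)

interpretation aut: group "aut_tree m" for m
  by (rule group_aut_tree)

text \<open>Adjacency makes the image of a child of \<open>u\<close> either a child or the parent of
  \<open>g u\<close>. The parent is excluded by injectivity, because by induction it is already the
  image of the parent of \<open>u\<close>.\<close>

lemma aut_length_butlast:
  assumes g: "g \<in> carrier (aut_tree m)" and "w \<in> words m"
  shows "length (g w) = length w \<and> (w \<noteq> [] \<longrightarrow> butlast (g w) = g (butlast w))"
  using \<open>w \<in> words m\<close>
proof (induction w rule: rev_induct)
  case Nil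
  then show ?case using g by simp
next
  case (snoc x u)
  then have u: "u \<in> words m" "length (g u) = length u" "u \<noteq> [] \<Longrightarrow> butlast (g u) = g (butlast u)"
    by auto
  have "adjacent u (u @ [x])"
    by (auto simp: adjacent_def)
  then have "adjacent (g u) (g (u @ [x]))"
    using g snoc.prems u(1) by (auto simp: aut_tree_iff)
  then consider y where "g (u @ [x]) = g u @ [y]" | y where "g u = g (u @ [x]) @ [y]"
    by (auto simp: adjacent_def)
  then show ?case
  proof cases
    case 1
    then show ?thesis using u by simp
  next
    case 2
    then have "u \<noteq> []"
      using g by auto
    then have "g (u @ [x]) = g (butlast u)"
      using 2 u(3) by (metis butlast_snoc)
    then have "u @ [x] = butlast u"
      using g by simp
    then have "length (u @ [x]) = length (butlast u)"
      by (rule arg_cong)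
    then show ?thesis by simp
  qed
qed

lemma aut_length [simp]: "g \<in> carrier (aut_tree m) \<Longrightarrow> length (g w) = length w"
  using aut_length_butlast[of g m w] aut_outside[of g m w] by (cases "w \<in> words m") auto

text \<open>Iterating the preservation of parents along \<open>u\<close> shows that
  \<open>g v\<close> is a prefix of \<open>g (v @ u)\<close>. This justifies defining the section by
  dropping \<open>length v\<close> letters.\<close>

lemma aut_append:
  assumes g: "g \<in> carrier (aut_tree m)" and "v \<in> words m" "u \<in> words m"
  shows "g (v @ u) = g v @ tree_section g v u"
proof -
  have "take (length v) (g (v @ u)) = g v"
    using \<open>u \<in> words m\<close>
  proof (induction u rule: rev_induct)
    case Nil
    then show ?case using g by simp
  next
    case (snoc x u)
    have "butlast (g (v @ u @ [x])) = g (v @ u)"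
      using aut_length_butlast[OF g, of "v @ u @ [x]"] snoc.prems \<open>v \<in> words m\<close>
      by (simp add: butlast_append)
    moreover have "take (length v) (butlast (g (v @ u @ [x]))) = take (length v) (g (v @ u @ [x]))"
      using g by (simp add: take_butlast)
    ultimately show ?case
      using snoc by simp
  qed
  then show ?thesis
    unfolding tree_section_def by (metis append_take_drop_id)
qed

section \<open>Local permutations and the iterated wreath product\<close>

lemma aut_snoc:
  assumes g: "g \<in> carrier (aut_tree m)" and w: "v @ [x] \<in> words m"
  shows "g (v @ [x]) = g v @ [local_perm g v x]"
proof -
  have "g (v @ [x]) = g v @ tree_section g v [x]"
    using aut_append[OF g] w by simp
  moreover have "length (tree_section g v [x]) = 1"
    using g by (simp add: tree_section_def)
  ultimately show ?thesis
    by (metis One_nat_def length_0_conv length_Suc_conv list.sel(1) local_perm_def)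
qed

text \<open>A word with a foreign letter is not a vertex and stays fixed. Thus equations between
  local permutations can hold as equations of functions on all of \<open>nat\<close>.\<close>

lemma local_perm_outside:
  assumes "g \<in> carrier (aut_tree m)" "x \<notin> {1..m}"
  shows "local_perm g v x = x"
proof -
  have "g (v @ [x]) = v @ [x]"
    using assms by (intro aut_outside[of g m]) auto
  then show ?thesis
    by (simp add: local_perm_def tree_section_def)
qed

text \<open>The chain rule: after \<open>g\<close>, the automorphism \<open>h\<close> acts on the
  children of \<open>g v\<close>, not of \<open>v\<close>.\<close>

lemma local_perm_comp:
  assumes g: "g \<in> carrier (aut_tree m)" and h: "h \<in> carrier (aut_tree m)" and v: "v \<in> words m"
  shows "local_perm (h \<circ> g) v = local_perm h (g v) \<circ> local_perm g v"
proof
  fix x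
  have hg: "h \<circ> g \<in> carrier (aut_tree m)"
    using aut.m_closed[OF g h] by simp
  show "local_perm (h \<circ> g) v x = (local_perm h (g v) \<circ> local_perm g v) x"
  proof (cases "x \<in> {1..m}")
    case True
    then have vx: "v @ [x] \<in> words m"
      using v by simp
    then have "g v @ [local_perm g v x] \<in> words m"
      using g v aut_snoc[OF g vx] by (metis aut_words)
    then show ?thesis
      using aut_snoc[OF hg vx] aut_snoc[OF g vx] aut_snoc[OF h] by simp
  next
    case False
    then show ?thesis
      using local_perm_outside assms hg by simp
  qed
qed

lemma local_perm_id [simp]: "local_perm id v = id"
  by (auto simp: local_perm_def tree_section_def)

lemma subgroup_wreath:
  assumes H: "subgroup H (sym_group m)"
  shows "subgroup (wreath m H) (aut_tree m)"
proof (rule aut.subgroupI)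
  show "wreath m H \<subseteq> carrier (aut_tree m)"
    by (auto simp: wreath_def)
  have "id \<in> wreath m H"
    using subgroup.one_closed[OF H] aut.one_closed[of m] by (simp add: wreath_def sym_group_one)
  then show "wreath m H \<noteq> {}"
    by auto
next
  fix g assume "g \<in> wreath m H"
  then have g: "g \<in> carrier (aut_tree m)" and gH: "\<And>v. v \<in> words m \<Longrightarrow> local_perm g v \<in> H"
    by (auto simp: wreath_def)
  let ?i = "inv\<^bsub>aut_tree m\<^esub> g"
  have i: "?i \<in> carrier (aut_tree m)"
    using g by simp
  have "local_perm ?i v \<in> H" if v: "v \<in> words m" for v
  proof -
    \<comment> \<open>By the chain rule for \<open>g \<circ> ?i = id\<close>, the local permutation
      of the inverse at \<open>v\<close> is inverse to that of \<open>g\<close> at the preimage of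
      \<open>v\<close>.\<close>
    define p where "p = local_perm g (?i v)"
    have pH: "p \<in> H"
      using gH i v by (simp add: p_def)
    then have "p permutes {1..m}"
      using subgroup.subset[OF H] by (auto simp: sym_group_def)
    moreover have "p \<circ> local_perm ?i v = id"
      using local_perm_comp[OF i g v] aut.l_inv[OF g] by (simp add: p_def)
    ultimately have "local_perm ?i v = inv' p"
      by (metis comp_assoc comp_id id_comp permutes_inv_o(2))
    moreover have "inv\<^bsub>sym_group m\<^esub> p \<in> H"
      using H pH by (rule subgroup.m_inv_closed)
    ultimately show ?thesis
      using pH subgroup.subset[OF H] by auto
  qed
  then show "?i \<in> wreath m H"
    using i by (simp add: wreath_def)
next
  fix g h assume "g \<in> wreath m H" "h \<in> wreath m H"
  moreover from this have "h \<circ> g \<in> carrier (aut_tree m)"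
    using aut.m_closed[of g m h] by (simp add: wreath_def)
  ultimately show "g \<otimes>\<^bsub>aut_tree m\<^esub> h \<in> wreath m H"
    using subgroup.m_closed[OF H] by (auto simp: wreath_def local_perm_comp sym_group_mult)
qed

section \<open>Branch groups have trivial center\<close>

lemma card_level: "card (level m n) = m ^ n"
proof -
  have "level m n = {xs. set xs \<subseteq> {1..m} \<and> length xs = n}"
    by (auto simp: level_def words_def in_lists_conv_set)
  then show ?thesis
    using card_lists_length_eq[of "{1..m}" n] by simp
qed

text \<open>An orbit of \<open>K\<close> has at most \<open>card K\<close> points, whereas level
  \<open>n\<close> has \<open>m ^ n \<ge> 2 ^ n > n\<close> vertices; the contradiction comes from
  \<open>n = card K\<close>.\<close>

lemma infinite_level_transitive:
  assumes "m \<ge> 2" and tr: "\<And>n u w. u \<in> level m n \<Longrightarrow> w \<in> level m n \<Longrightarrow> \<exists>g \<in> K. g u = w"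
  shows "infinite K"
proof
  assume fin: "finite K"
  define n where "n = card K"
  have "card (level m n) \<noteq> 0"
    using \<open>m \<ge> 2\<close> by (simp add: card_level)
  then obtain u where u: "u \<in> level m n"
    by fastforce
  have "level m n \<subseteq> (\<lambda>g. g u) ` K"
    using tr[OF u] by blast
  then have "card (level m n) \<le> n"
    unfolding n_def by (rule surj_card_le[OF fin])
  then have "m ^ n \<le> n"
    by (simp only: card_level)
  also have "n < 2 ^ n"
    by (rule less_exp)
  also have "2 ^ n \<le> m ^ n"
    using \<open>m \<ge> 2\<close> by (rule power_mono) simp
  finally show False
    by simp
qed

text \<open>The element \<open>z\<close> carries the subtree at \<open>v\<close> off itself, to a
  place where a rigid element \<open>r\<close> at \<open>v\<close> acts trivially. Commuting with
  \<open>z\<close>, \<open>r\<close> then acts trivially on the subtree at \<open>v\<close>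
  too.\<close>

lemma rist_moved_by_center:
  assumes K: "K \<subseteq> carrier (aut_tree m)" and z: "z \<in> K" "\<And>g. g \<in> K \<Longrightarrow> z \<circ> g = g \<circ> z"
    and v: "v \<in> words m" "z v \<noteq> v"
  shows "rist m K v \<subseteq> {id}"
proof
  fix r assume r: "r \<in> rist m K v"
  have "r \<in> K" and r_fix: "\<And>w. w \<in> words m \<Longrightarrow> (\<nexists>u. w = v @ u) \<Longrightarrow> r w = w"
    using r by (auto simp: rist_def)
  have rc: "r \<in> carrier (aut_tree m)" and zc: "z \<in> carrier (aut_tree m)"
    using \<open>r \<in> K\<close> z K by auto
  have "r w = w" if w: "w \<in> words m" for w
  proof (cases "\<exists>u. w = v @ u")
    case True
    then obtain u where u: "w = v @ u"
      by blast
    have "z w = z v @ tree_section z v u"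
      using aut_append[OF zc] u w by simp
    \<comment> \<open>The words \<open>z v\<close> and \<open>v\<close> have equal length, so a
      common extension would make them equal.\<close>
    then have "\<nexists>u'. z w = v @ u'"
      using v(2) aut_length[OF zc, of v] by auto
    then have "r (z w) = z w"
      using r_fix zc w by simp
    then have "z (r w) = z w"
      using z(2)[OF \<open>r \<in> K\<close>] by (metis comp_apply)
    then show ?thesis
      using zc by simp
  qed (use r_fix w in blast)
  then have "r w = w" for w
    using aut_outside[OF rc, of w] by blast
  then show "r \<in> {id}"
    by (simp add: fun_eq_iff)
qed

lemma branch_center_trivial:
  assumes "m \<ge> 2" and K: "branch m K" and z: "z \<in> K" "\<And>g. g \<in> K \<Longrightarrow> z \<circ> g = g \<circ> z"
  shows "z = id"
proof (rule ccontr)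
  assume "z \<noteq> id"
  have sub: "subgroup K (aut_tree m)"
    using K unfolding branch_def by (rule conjunct1)
  have tr: "\<exists>g \<in> K. g u = w" if "u \<in> level m n" "w \<in> level m n" for n u w
    using K that unfolding branch_def by metis
  have fin: "finite (rcosets\<^bsub>restrict_to (aut_tree m) K\<^esub> Rist m K n)" if "n \<ge> 1" for n
    using K that unfolding branch_def by metis
  have Kc: "K \<subseteq> carrier (aut_tree m)"
    using sub by (rule subgroup.subset)
  then have zc: "z \<in> carrier (aut_tree m)"
    using z by auto
  obtain v where v: "z v \<noteq> v"
    using \<open>z \<noteq> id\<close> by (auto simp: fun_eq_iff)
  define n where "n = length v"
  have vn: "v \<in> level m n"
    using v aut_outside[OF zc] by (auto simp: level_def n_def)
  \<comment> \<open>The root is fixed, so the moved vertex lies on a level where the finite index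
    condition applies.\<close>
  have "n \<ge> 1"
    using v zc by (cases v) (auto simp: n_def)
  have "rist m K w \<subseteq> {id}" if w: "w \<in> level m n" for w
  proof (rule rist_moved_by_center[OF Kc z])
    obtain g where g: "g \<in> K" "g v = w"
      using tr[OF vn w] by blast
    \<comment> \<open>Commuting with \<open>g\<close> transports the displacement from
      \<open>v\<close> to \<open>w\<close>.\<close>
    have "z w = g (z v)"
      using g z(2)[OF g(1)] by (metis comp_apply)
    then show "z w \<noteq> w"
      using v g Kc by auto
  qed (use w in \<open>auto simp: level_def\<close>)
  then have "Rist m K n \<subseteq> {id}"
    unfolding Rist_def using aut.generate_subgroup_incl[OF _ aut.triv_subgroup]
    by (metis (no_types, lifting) UN_least aut_tree_one)
  moreover have "id \<in> Rist m K n"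
    unfolding Rist_def using generate.one[of "aut_tree m"] by simp
  ultimately have Rist: "Rist m K n = {id}"
    by blast
  \<comment> \<open>Cosets of the trivial group are singletons, so finite index forces
    \<open>K\<close> to be finite.\<close>
  have "(\<lambda>k. {k}) ` K \<subseteq> rcosets\<^bsub>restrict_to (aut_tree m) K\<^esub> Rist m K n"
    by (auto simp: Rist RCOSETS_def r_coset_def)
  then have "finite ((\<lambda>k. {k}) ` K)"
    using fin[OF \<open>n \<ge> 1\<close>] finite_subset by blast
  then have "finite K"
    by (rule finite_imageD) (auto simp: inj_on_def)
  moreover have "infinite K"
    using \<open>m \<ge> 2\<close> tr by (rule infinite_level_transitive)
  ultimately show False
    by blast
qed

section \<open>The direct product of the rooted and the diagonal action\<close>

text \<open>The pair \<open>(h, k)\<close> realised as one tree map. It is the identity off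
  \<open>words m\<close>, as \<open>permutes\<close> demands of members of
  \<open>aut_tree m\<close>.\<close>

definition prod_act :: "nat \<Rightarrow> (nat \<Rightarrow> nat) \<Rightarrow> (nat list \<Rightarrow> nat list) \<Rightarrow> nat list \<Rightarrow> nat list"
  where "prod_act m h k w =
    (if w \<in> words m then case w of [] \<Rightarrow> [] | x # u \<Rightarrow> h x # k u else w)"

lemma prod_act_simps [simp]:
  "prod_act m h k [] = []"
  "x \<in> {1..m} \<Longrightarrow> u \<in> words m \<Longrightarrow> prod_act m h k (x # u) = h x # k u"
  "w \<notin> words m \<Longrightarrow> prod_act m h k w = w"
  by (simp_all add: prod_act_def)

text \<open>First letter and remainder are acted on independently. The hypotheses on
  \<open>h\<close> and \<open>k\<close> keep the intermediate word a vertex, where the outer map is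
  evaluated letter and remainder apart.\<close>

lemma prod_act_comp:
  assumes h: "h permutes {1..m}" and k: "k \<in> carrier (aut_tree m)"
  shows "prod_act m h' k' \<circ> prod_act m h k = prod_act m (h' \<circ> h) (k' \<circ> k)"
proof
  fix w
  have "prod_act m h' k' (h x # k u) = h' (h x) # k' (k u)" if "x # u \<in> words m" for x u
    using that h k permutes_in_image[OF h] by auto
  then show "(prod_act m h' k' \<circ> prod_act m h k) w = prod_act m (h' \<circ> h) (k' \<circ> k) w"
    by (cases w; cases "w \<in> words m") auto
qed

lemma prod_act_id [simp]: "prod_act m id id = id"
proof
  fix w show "prod_act m id id w = id w"
    by (cases w; cases "w \<in> words m") auto
qed

lemma prod_act_carrier:
  assumes h: "h permutes {1..m}" and k: "k \<in> carrier (aut_tree m)"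
  shows "prod_act m h k \<in> carrier (aut_tree m)"
  unfolding aut_tree_iff
proof (intro conjI ballI)
  have k': "inv\<^bsub>aut_tree m\<^esub> k \<in> carrier (aut_tree m)" and h': "inv' h permutes {1..m}"
    using k permutes_inv[OF h] by auto
  have mem: "prod_act m h k w \<in> words m \<longleftrightarrow> w \<in> words m" for w
    using permutes_in_image[OF h] k by (cases w; cases "w \<in> words m") auto
  \<comment> \<open>Bijectivity comes from the explicit two-sided inverse given by the pair of
    inverses.\<close>
  have "prod_act m h k \<circ> prod_act m (inv' h) (inv\<^bsub>aut_tree m\<^esub> k) = id"
    using prod_act_comp[OF h' k'] aut.l_inv[OF k] permutes_inv_o(1)[OF h] by simp
  moreover have "prod_act m (inv' h) (inv\<^bsub>aut_tree m\<^esub> k) \<circ> prod_act m h k = id"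
    using prod_act_comp[OF h k] aut.r_inv[OF k] permutes_inv_o(2)[OF h] by simp
  ultimately have "bij (prod_act m h k)"
    using o_bij by blast
  then show "prod_act m h k permutes words m"
    by (simp add: permutes_def bij_iff)
  fix u w assume uw: "u \<in> words m" "w \<in> words m"
  show "adjacent (prod_act m h k u) (prod_act m h k w) \<longleftrightarrow> adjacent u w"
  proof (cases u; cases w)
    fix x u' y w' assume eq: "u = x # u'" "w = y # w'"
    have "adjacent (k u') (k w') \<longleftrightarrow> adjacent u' w'"
      using k uw eq by (auto simp: aut_tree_iff)
    moreover have "h x = h y \<longleftrightarrow> x = y"
      using permutes_inj[OF h] by (auto dest: injD)
    ultimately show ?thesis
      using uw eq by auto
  next
    fix y w' assume eq: "u = []" "w = y # w'"
    have "k w' = [] \<longleftrightarrow> w' = []"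
      using aut_eq_iff[OF k, of w' "[]"] k by simp
    then show ?thesis
      using uw eq by auto
  next
    fix x u' assume eq: "u = x # u'" "w = []"
    have "k u' = [] \<longleftrightarrow> u' = []"
      using aut_eq_iff[OF k, of u' "[]"] k by simp
    then show ?thesis
      using uw eq by auto
  qed simp
qed simp

text \<open>Recovers the second coordinate of the pair; the root permutation recovers the first.
  Together they make the pair unique.\<close>

lemma section_prod_act:
  assumes "k \<in> carrier (aut_tree m)" "x \<in> {1..m}"
  shows "tree_section (prod_act m h k) [x] = k"
proof
  fix u show "tree_section (prod_act m h k) [x] u = k u"
    using assms aut_outside[OF assms(1)] by (cases "u \<in> words m") (auto simp: tree_section_def)
qed

lemma local_perm_prod_act_Nil:
  assumes "h permutes {1..m}" "k \<in> carrier (aut_tree m)"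
  shows "local_perm (prod_act m h k) [] = h"
proof
  fix x show "local_perm (prod_act m h k) [] x = h x"
    using assms permutes_not_in[OF assms(1)]
    by (cases "x \<in> {1..m}") (auto simp: tree_section_def local_perm_def)
qed

lemma local_perm_prod_act_Cons:
  assumes "k \<in> carrier (aut_tree m)" "x # v \<in> words m"
  shows "local_perm (prod_act m h k) (x # v) = local_perm k v"
proof
  fix y show "local_perm (prod_act m h k) (x # v) y = local_perm k v y"
    using assms aut_outside[OF assms(1)]
    by (cases "y \<in> {1..m}") (auto simp: tree_section_def local_perm_def)
qed

text \<open>With trivial local permutations below the root, every letter after the first is kept;
  this is an induction appending letters on the right.\<close>

lemma rooted_eq:
  assumes H: "\<And>h. h \<in> H \<Longrightarrow> h permutes {1..m}"
  shows "rooted m H = (\<lambda>h. prod_act m h id) ` H"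
proof (intro subset_antisym subsetI)
  fix g assume "g \<in> rooted m H"
  then have g: "g \<in> carrier (aut_tree m)" and h: "local_perm g [] \<in> H"
    and triv: "\<And>v. v \<in> words m \<Longrightarrow> v \<noteq> [] \<Longrightarrow> local_perm g v = id"
    by (auto simp: rooted_def)
  have *: "g (x # u) = local_perm g [] x # u" if "x # u \<in> words m" for x u
    using that
  proof (induction u rule: rev_induct)
    case Nil
    then show ?case using aut_snoc[OF g, of "[]" x] g by simp
  next
    case (snoc y u)
    then show ?case using aut_snoc[OF g, of "x # u" y] triv[of "x # u"] by simp
  qed
  have "g w = prod_act m (local_perm g []) id w" for w
    using * aut_outside[OF g] g by (cases w; cases "w \<in> words m") auto
  then show "g \<in> (\<lambda>h. prod_act m h id) ` H"
    using h by blast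
next
  fix g assume "g \<in> (\<lambda>h. prod_act m h id) ` H"
  then obtain h where h: "h \<in> H" and g: "g = prod_act m h id"
    by blast
  have "local_perm g v = id" if "v \<in> words m" "v \<noteq> []" for v
    using that aut.one_closed[of m]
    by (cases v) (auto simp: g local_perm_prod_act_Cons simp del: words_simps)
  then show "g \<in> rooted m H"
    using H[OF h] h aut.one_closed[of m] prod_act_carrier[of h m id]
    by (auto simp: rooted_def g local_perm_prod_act_Nil)
qed

text \<open>Fixing level 1 keeps the first letter, and the diagonal condition makes all level 1
  sections equal to one \<open>k\<close>, which is the pair \<open>(id, k)\<close>.\<close>

lemma diag_subgroup_eq:
  assumes "m \<ge> 1" and K: "K \<subseteq> carrier (aut_tree m)"
  shows "diag_subgroup m K = prod_act m id ` K"
proof (intro subset_antisym subsetI)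
  fix g assume "g \<in> diag_subgroup m K"
  then obtain k where g: "g \<in> carrier (aut_tree m)" and fix1: "\<And>w. w \<in> level m 1 \<Longrightarrow> g w = w"
    and k: "k \<in> K" and "psi m g = (\<lambda>x \<in> {1..m}. k)"
    by (auto simp: diag_subgroup_def level_stab_def)
  then have sec: "tree_section g [x] = k" if "x \<in> {1..m}" for x
    using that by (metis psi_def restrict_apply')
  have "g (x # u) = x # k u" if "x # u \<in> words m" for x u
    using that aut_append[OF g, of "[x]" u] sec fix1[of "[x]"] by (simp add: level_def)
  then have "g w = prod_act m id k w" for w
    using aut_outside[OF g] g by (cases w; cases "w \<in> words m") auto
  then show "g \<in> prod_act m id ` K"
    using k by blast
next
  fix g assume "g \<in> prod_act m id ` K"
  then obtain k where k: "k \<in> K" and g: "g = prod_act m id k"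
    by blast
  have kc: "k \<in> carrier (aut_tree m)"
    using k K by auto
  have "psi m g = (\<lambda>x \<in> {1..m}. k)"
    using section_prod_act[OF kc] by (auto simp: psi_def g)
  moreover have "g w = w" if "w \<in> level m 1" for w
    using that kc by (cases w) (auto simp: level_def g)
  ultimately show "g \<in> diag_subgroup m K"
    using k prod_act_carrier[OF permutes_id kc]
    by (auto simp: diag_subgroup_def level_stab_def g)
qed

text \<open>Any subgroup \<open>H\<close> of the symmetric group is allowed, so that the locale can
  also be instantiated with \<open>{id}\<close>. The branch property of \<open>K\<close> is left to
  the final theorem.\<close>

locale rooted_diagonal =
  fixes m :: nat and H :: "(nat \<Rightarrow> nat) set" and K :: "(nat list \<Rightarrow> nat list) set"
  assumes m_pos: "m \<ge> 1"
    and H: "subgroup H (sym_group m)"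
    and K: "subgroup K (aut_tree m)"
begin

section \<open>Elements of G_K as pairs from H and K\<close>

lemma H_permutes: "h \<in> H \<Longrightarrow> h permutes {1..m}"
  using subgroup.subset[OF H] by (auto simp: sym_group_def)

lemma H_id: "id \<in> H"
  using subgroup.one_closed[OF H] by (simp add: sym_group_one)

lemma H_comp: "h \<in> H \<Longrightarrow> h' \<in> H \<Longrightarrow> h' \<circ> h \<in> H"
  using subgroup.m_closed[OF H] by (simp add: sym_group_mult)

lemma H_inv: "h \<in> H \<Longrightarrow> inv' h \<in> H"
  using subgroup.m_inv_closed[OF H, of h] subgroup.subset[OF H]
  by (metis subsetD sym_group_inv_equality)

lemma K_carrier: "k \<in> K \<Longrightarrow> k \<in> carrier (aut_tree m)"
  using subgroup.subset[OF K] by auto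

lemma K_id: "id \<in> K"
  using subgroup.one_closed[OF K] by simp

lemma K_comp: "k \<in> K \<Longrightarrow> k' \<in> K \<Longrightarrow> k' \<circ> k \<in> K"
  using subgroup.m_closed[OF K] by simp

lemma prod_act_eq_iff:
  assumes "h \<in> H" "h' \<in> H" "k \<in> K" "k' \<in> K"
  shows "prod_act m h k = prod_act m h' k' \<longleftrightarrow> h = h' \<and> k = k'"
proof -
  have "1 \<in> {1..m}"
    using m_pos by simp
  then show ?thesis
    using assms section_prod_act local_perm_prod_act_Nil H_permutes K_carrier by metis
qed

lemma prod_act_comp_HK:
  "h \<in> H \<Longrightarrow> k \<in> K \<Longrightarrow> prod_act m h' k' \<circ> prod_act m h k = prod_act m (h' \<circ> h) (k' \<circ> k)"
  by (intro prod_act_comp H_permutes K_carrier)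

lemma prod_act_HK_carrier: "h \<in> H \<Longrightarrow> k \<in> K \<Longrightarrow> prod_act m h k \<in> carrier (aut_tree m)"
  by (intro prod_act_carrier H_permutes K_carrier)

lemma local_perm_HK: "h \<in> H \<Longrightarrow> k \<in> K \<Longrightarrow> local_perm (prod_act m h k) [] = h"
  by (intro local_perm_prod_act_Nil H_permutes K_carrier)

lemma rooted_image: "rooted m H = (\<lambda>h. prod_act m h id) ` H"
  using rooted_eq H_permutes by blast

lemma diag_image: "diag_subgroup m K = prod_act m id ` K"
  using diag_subgroup_eq[OF m_pos] K_carrier by blast

lemma subgroup_prod_act_image:
  "subgroup {prod_act m h k | h k. h \<in> H \<and> k \<in> K} (aut_tree m)" (is "subgroup ?P _")
proof (rule aut.subgroupI)
  show sub: "?P \<subseteq> carrier (aut_tree m)"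
    using prod_act_carrier H_permutes K_carrier by blast
  show "?P \<noteq> {}"
    using H_id K_id by blast
  fix g assume "g \<in> ?P"
  then obtain h k where hk: "h \<in> H" "k \<in> K" and g: "g = prod_act m h k"
    by blast
  let ?k = "inv\<^bsub>aut_tree m\<^esub> k"
  have k: "?k \<in> K"
    using K hk by (simp add: subgroup.m_inv_closed)
  have "prod_act m (inv' h) ?k \<otimes>\<^bsub>aut_tree m\<^esub> g = \<one>\<^bsub>aut_tree m\<^esub>"
    using prod_act_comp_HK[OF H_inv[OF hk(1)] k] hk aut.l_inv[OF K_carrier[OF hk(2)]]
      permutes_inv_o(1)[OF H_permutes[OF hk(1)]]
    by (simp add: g)
  moreover have "prod_act m (inv' h) ?k \<in> ?P"
    using H_inv hk k by blast
  ultimately show "inv\<^bsub>aut_tree m\<^esub> g \<in> ?P"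
    using aut.inv_equality sub \<open>g \<in> ?P\<close> by (metis (no_types, lifting) subsetD)
next
  fix g g' assume "g \<in> ?P" "g' \<in> ?P"
  then obtain h k h' k' where "h \<in> H" "k \<in> K" "h' \<in> H" "k' \<in> K"
    and "g = prod_act m h k" "g' = prod_act m h' k'"
    by blast
  then show "g \<otimes>\<^bsub>aut_tree m\<^esub> g' \<in> ?P"
    using H_comp[of h h'] K_comp[of k k'] by (auto simp: prod_act_comp_HK)
qed

text \<open>Both kinds of generators are pairs with one trivial coordinate and the pairs form a
  subgroup; conversely \<open>(h, k)\<close> is the product of \<open>(id, k)\<close> and
  \<open>(h, id)\<close>. This normal form drives all later computations in
  \<open>GK\<close>.\<close>

lemma carrier_GK: "carrier (GK m H K) = {prod_act m h k | h k. h \<in> H \<and> k \<in> K}"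
proof -
  let ?P = "{prod_act m h k | h k. h \<in> H \<and> k \<in> K}"
  let ?S = "rooted m H \<union> diag_subgroup m K"
  have "?S \<subseteq> ?P"
    unfolding rooted_image diag_image using H_id K_id by blast
  then have "generate (aut_tree m) ?S \<subseteq> ?P"
    using aut.generate_subgroup_incl subgroup_prod_act_image by blast
  moreover have "prod_act m h k \<in> generate (aut_tree m) ?S" if hk: "h \<in> H" "k \<in> K" for h k
  proof -
    have "prod_act m id k \<otimes>\<^bsub>aut_tree m\<^esub> prod_act m h id \<in> generate (aut_tree m) ?S"
      using hk by (intro generate.eng generate.incl) (auto simp: rooted_image diag_image)
    then show ?thesis
      using hk H_id by (simp add: prod_act_comp_HK)
  qed
  ultimately show ?thesis
    by (auto simp: GK_def)
qed

lemma prod_act_in_GK: "h \<in> H \<Longrightarrow> k \<in> K \<Longrightarrow> prod_act m h k \<in> carrier (GK m H K)"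
  by (auto simp: carrier_GK)

lemma GK_cases:
  assumes "g \<in> carrier (GK m H K)"
  obtains h k where "h \<in> H" "k \<in> K" "g = prod_act m h k"
  using assms by (auto simp: carrier_GK)

lemma GK_mult: "g \<otimes>\<^bsub>GK m H K\<^esub> g' = g' \<circ> g"
  by (simp add: GK_def)

lemma subgroup_GK: "subgroup (carrier (GK m H K)) (aut_tree m)"
  unfolding carrier_GK by (rule subgroup_prod_act_image)

lemma group_GK: "group (GK m H K)"
  using aut.subgroup_imp_group[OF subgroup_GK] by (simp add: GK_def)

text \<open>The root permutation of \<open>(h, k)\<close> is \<open>h\<close>, and every lower local
  permutation is one of \<open>k\<close>, hence in \<open>H\<close> because \<open>K\<close> lies in
  the wreath product.\<close>

lemma GK_subset_wreath:
  assumes "K \<subseteq> wreath m H"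
  shows "carrier (GK m H K) \<subseteq> wreath m H"
proof
  fix g assume "g \<in> carrier (GK m H K)"
  then obtain h k where hk: "h \<in> H" "k \<in> K" and g: "g = prod_act m h k"
    by (rule GK_cases)
  have local: "local_perm g v \<in> H" if "v \<in> words m" for v
  proof (cases v)
    case Nil
    then show ?thesis
      using hk by (simp add: g local_perm_HK)
  next
    case (Cons x u)
    then have "local_perm g v = local_perm k u" "u \<in> words m"
      using that local_perm_prod_act_Cons[OF K_carrier[OF hk(2)], of x u h] by (auto simp: g)
    then show ?thesis
      using hk assms by (auto simp: wreath_def)
  qed
  then show "g \<in> wreath m H"
    using hk local by (simp add: wreath_def g prod_act_HK_carrier)
qed

section \<open>The quotient of G_K by H\<close>

text \<open>The retraction of \<open>G\<^sub>K = H \<times> D\<^sub>m(K)\<close> onto its second factor.\<close>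

definition diag_part :: "(nat list \<Rightarrow> nat list) \<Rightarrow> nat list \<Rightarrow> nat list"
  where "diag_part g = prod_act m id (tree_section g [1])"

lemma diag_part_prod_act [simp]: "k \<in> K \<Longrightarrow> diag_part (prod_act m h k) = prod_act m id k"
  using m_pos by (simp add: diag_part_def section_prod_act K_carrier)

lemma subgroup_diag: "subgroup (diag_subgroup m K) (aut_tree m)"
proof -
  \<comment> \<open>D_m(K) is the set of pairs whose first group is trivial, so the subgroup
    property of pairs is reused with \<open>{id}\<close> in place of \<open>H\<close>.\<close>
  have "subgroup {id} (sym_group m)"
    using group.triv_subgroup[OF sym_group_is_group, of m] by (simp add: sym_group_one)
  then interpret T: rooted_diagonal m "{id}" K
    using m_pos K by (intro rooted_diagonal.intro)
  have "{prod_act m h k | h k. h \<in> {id} \<and> k \<in> K} = diag_subgroup m K"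
    by (auto simp: diag_image)
  then show ?thesis
    using T.subgroup_prod_act_image by simp
qed

lemma diag_part_hom: "group_hom (GK m H K) (restrict_to (aut_tree m) (diag_subgroup m K)) diag_part"
proof (intro group_hom.intro group_hom_axioms.intro)
  show "group (GK m H K)"
    by (rule group_GK)
  show "group (restrict_to (aut_tree m) (diag_subgroup m K))"
    by (rule aut.subgroup_imp_group[OF subgroup_diag])
  show "diag_part \<in> hom (GK m H K) (restrict_to (aut_tree m) (diag_subgroup m K))"
    by (rule homI)
      (auto elim!: GK_cases simp: GK_mult diag_image prod_act_comp_HK K_comp H_id)
qed

lemma kernel_diag_part:
  "kernel (GK m H K) (restrict_to (aut_tree m) (diag_subgroup m K)) diag_part = rooted m H"
proof -
  have "prod_act m id k = id \<longleftrightarrow> k = id" if "k \<in> K" for k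
    using prod_act_eq_iff[OF H_id H_id that K_id] by simp
  then show ?thesis
    using K_id by (auto simp: kernel_def rooted_image carrier_GK)
qed

lemma diag_part_surj: "diag_part ` carrier (GK m H K) = diag_subgroup m K"
proof (intro subset_antisym subsetI)
  fix d assume "d \<in> diag_subgroup m K"
  then obtain k where "k \<in> K" "d = diag_part (prod_act m id k)"
    by (auto simp: diag_image)
  then show "d \<in> diag_part ` carrier (GK m H K)"
    using prod_act_in_GK[OF H_id] by blast
qed (auto elim!: GK_cases simp: diag_image)

text \<open>A coset of H varies only the first coordinate, which \<open>diag_part\<close> forgets;
  its image is therefore a singleton. This evaluates the isomorphism induced on the
  quotient.\<close>

lemma diag_part_coset:
  assumes g: "g \<in> carrier (GK m H K)"
  shows "the_elem (diag_part ` (rooted m H #>\<^bsub>GK m H K\<^esub> g)) = diag_part g"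
proof -
  obtain h k where hk: "h \<in> H" "k \<in> K" and g: "g = prod_act m h k"
    using g by (rule GK_cases)
  have "rooted m H #>\<^bsub>GK m H K\<^esub> g = (\<lambda>h'. prod_act m (h \<circ> h') k) ` H"
    using hk K_id by (auto simp: r_coset_def rooted_image GK_mult g prod_act_comp_HK)
  then have "diag_part ` (rooted m H #>\<^bsub>GK m H K\<^esub> g) = {diag_part g}"
    using hk H_id by (auto simp: g image_image)
  then show ?thesis
    by simp
qed

section \<open>The center of G_K and the action at level 1\<close>

lemma prod_act_commute_iff:
  assumes "h \<in> H" "k \<in> K" "h' \<in> H" "k' \<in> K"
  shows "prod_act m h k \<circ> prod_act m h' k' = prod_act m h' k' \<circ> prod_act m h k
    \<longleftrightarrow> h \<circ> h' = h' \<circ> h \<and> k \<circ> k' = k' \<circ> k"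
  using assms by (simp add: prod_act_comp_HK prod_act_eq_iff H_comp K_comp)

text \<open>Commutation is checked coordinate by coordinate, so the center is Z(H) x Z(K); the
  hypothesis says that Z(K) is trivial.\<close>

lemma center_GK:
  assumes Z: "\<And>z. z \<in> K \<Longrightarrow> (\<And>k. k \<in> K \<Longrightarrow> z \<circ> k = k \<circ> z) \<Longrightarrow> z = id"
  shows "center (GK m H K) =
    (\<lambda>h. prod_act m h id) ` center (restrict_to (sym_group m) H)" (is "?L = ?R")
proof (intro subset_antisym subsetI)
  fix g assume g: "g \<in> ?L"
  then have "g \<in> carrier (GK m H K)"
    by (simp add: center_def)
  then obtain h k where hk: "h \<in> H" "k \<in> K" and g_eq: "g = prod_act m h k"
    by (rule GK_cases)
  have comm: "h \<circ> h' = h' \<circ> h \<and> k \<circ> k' = k' \<circ> k" if "h' \<in> H" "k' \<in> K" for h' k'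
  proof -
    have "g \<circ> prod_act m h' k' = prod_act m h' k' \<circ> g"
      using g prod_act_in_GK[OF that] by (auto simp: center_def GK_mult)
    then show ?thesis
      using prod_act_commute_iff[OF hk that] g_eq by simp
  qed
  \<comment> \<open>Testing against the pairs \<open>(id, k')\<close> shows that \<open>k\<close> is
    central in \<open>K\<close>.\<close>
  have "k = id"
    using Z hk(2) comm[OF H_id] by blast
  then show "g \<in> ?R"
    using hk(1) comm[OF _ K_id] by (auto simp: g_eq center_def sym_group_mult)
next
  fix g assume "g \<in> ?R"
  then obtain h where h: "h \<in> H" "\<And>h'. h' \<in> H \<Longrightarrow> h \<circ> h' = h' \<circ> h" and g: "g = prod_act m h id"
    by (auto simp: center_def sym_group_mult)
  have "g \<circ> g' = g' \<circ> g" if "g' \<in> carrier (GK m H K)" for g'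
    using that prod_act_commute_iff[OF h(1) K_id] h by (auto elim!: GK_cases simp: g)
  then show "g \<in> ?L"
    using prod_act_in_GK[OF h(1) K_id] by (simp add: center_def GK_mult g)
qed

lemma center_GK_iso:
  assumes Z: "\<And>z. z \<in> K \<Longrightarrow> (\<And>k. k \<in> K \<Longrightarrow> z \<circ> k = k \<circ> z) \<Longrightarrow> z = id"
  shows "restrict_to (GK m H K) (center (GK m H K)) \<cong>
    restrict_to (sym_group m) (center (restrict_to (sym_group m) H))"
proof -
  let ?Z = "center (restrict_to (sym_group m) H)"
  have center: "center (GK m H K) = (\<lambda>h. prod_act m h id) ` ?Z"
    using Z by (rule center_GK)
  have ZH: "?Z \<subseteq> H"
    by (auto simp: center_def)
  have perm: "local_perm (prod_act m h id) [] = h" if "h \<in> ?Z" for h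
    using that ZH K_id by (auto simp: local_perm_HK)
  have "bij_betw (\<lambda>g. local_perm g []) (center (GK m H K)) ?Z"
    unfolding center
    by (rule bij_betw_byWitness[where f' = "\<lambda>h. prod_act m h id"]) (auto simp: perm)
  moreover have "local_perm (prod_act m h' id \<circ> prod_act m h id) [] = h \<circ> h'"
    if "h \<in> ?Z" "h' \<in> ?Z" for h h'
  proof -
    have hh: "h \<in> H" "h' \<in> H"
      using that ZH by auto
    \<comment> \<open>\<open>GK\<close> applies the left factor first and \<open>sym_group\<close>
      the right one; centrality reconciles the two orders, so the root permutation is a homomorphism
      here.\<close>
    then have "h' \<circ> h = h \<circ> h'"
      using that(1) by (simp add: center_def sym_group_mult)
    then show ?thesis
      using hh K_id H_comp[OF hh] by (simp add: prod_act_comp_HK local_perm_HK)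
  qed
  ultimately have "(\<lambda>g. local_perm g []) \<in> iso (restrict_to (GK m H K) (center (GK m H K)))
      (restrict_to (sym_group m) ?Z)"
    by (auto simp: iso_def hom_def center perm GK_mult sym_group_mult)
  then show ?thesis
    by (auto simp: is_iso_def)
qed

text \<open>Contrapositive form of the last claim: rooted elements that are central in
  \<open>GK\<close> commute with each other.\<close>

lemma comm_group_if_rooted_central:
  assumes "rooted m H \<subseteq> center (GK m H K)"
  shows "comm_group (restrict_to (sym_group m) H)"
proof (rule group.group_comm_groupI)
  show "group (restrict_to (sym_group m) H)"
    by (rule group.subgroup_imp_group[OF sym_group_is_group H])
  fix h h' assume "h \<in> carrier (restrict_to (sym_group m) H)" "h' \<in> carrier (restrict_to (sym_group m) H)"
  then have hh: "h \<in> H" "h' \<in> H"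
    by auto
  have "prod_act m h id \<in> center (GK m H K)"
    using assms hh by (auto simp: rooted_image)
  then have "prod_act m h id \<circ> prod_act m h' id = prod_act m h' id \<circ> prod_act m h id"
    using prod_act_in_GK[OF hh(2) K_id] by (auto simp: center_def GK_mult)
  then show "h \<otimes>\<^bsub>restrict_to (sym_group m) H\<^esub> h' = h' \<otimes>\<^bsub>restrict_to (sym_group m) H\<^esub> h"
    using prod_act_commute_iff[OF hh(1) K_id hh(2) K_id] by (simp add: sym_group_mult)
qed

text \<open>All level 1 sections of \<open>diag_part (prod_act m h k)\<close> equal
  \<open>k\<close>, so for every \<open>v\<close> the map is the projection of a pair to its second
  coordinate.\<close>

lemma level_one_action:
  assumes v: "v \<in> level m 1"
  defines "f \<equiv> \<lambda>g. tree_section (diag_part g) v"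
  shows "f \<in> hom (GK m H K) (restrict_to (aut_tree m) K)"
    and "f ` carrier (GK m H K) = K"
    and "kernel (GK m H K) (restrict_to (aut_tree m) K) f = rooted m H"
proof -
  obtain x where x: "v = [x]" "x \<in> {1..m}"
    using v by (auto simp: level_def length_Suc_conv)
  have f: "f (prod_act m h k) = k" if "k \<in> K" for h k
    using that x section_prod_act K_carrier by (simp add: f_def)
  show "f \<in> hom (GK m H K) (restrict_to (aut_tree m) K)"
    by (rule homI) (auto elim!: GK_cases simp: GK_mult prod_act_comp_HK f K_comp)
  show "f ` carrier (GK m H K) = K"
  proof (intro subset_antisym subsetI)
    fix k assume k: "k \<in> K"
    then show "k \<in> f ` carrier (GK m H K)"
      using prod_act_in_GK[OF H_id k] f[OF k, of id] by (metis image_eqI)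
  qed (auto elim!: GK_cases simp: f)
  show "kernel (GK m H K) (restrict_to (aut_tree m) K) f = rooted m H"
    using K_id by (auto simp: kernel_def rooted_image carrier_GK f)
qed

end

theorem mainTheorem7:
  fixes m :: nat
    and H :: "(nat \<Rightarrow> nat) set"
    and K :: "(nat list \<Rightarrow> nat list) set"
  assumes "m \<ge> 2"
    and "subgroup H (sym_group m)"
    and "transitive_perms m H"
    and "subgroup K (restrict_to (aut_tree m) (wreath m H))"
    and "closedin (aut_topology m) K"
    and "branch m K"
  shows "subgroup (carrier (GK m H K)) (restrict_to (aut_tree m) (wreath m H)) \<and>
    rooted m H \<lhd> GK m H K \<and>
    (\<exists>\<theta> \<in> iso (GK m H K Mod rooted m H) (restrict_to (aut_tree m) (diag_subgroup m K)).
      (\<forall>d \<in> diag_subgroup m K. \<theta> (rooted m H #>\<^bsub>GK m H K\<^esub> d) = d) \<and>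
      (\<forall>v \<in> level m 1.
        let \<pi> = (\<lambda>g. \<theta> (rooted m H #>\<^bsub>GK m H K\<^esub> g));
            \<phi> = (\<lambda>g. tree_section g v);
            f = \<phi> \<circ> \<pi>
        in f \<in> hom (GK m H K) (restrict_to (aut_tree m) K) \<and>
           f \<in> hom (GK m H K) (aut_tree m) \<and>
           f ` carrier (GK m H K) = K \<and>
           kernel (GK m H K) (restrict_to (aut_tree m) K) f = rooted m H \<and>
           branch m (f ` carrier (GK m H K)) \<and>
           (\<not> comm_group (restrict_to (sym_group m) H) \<longrightarrow>
             \<not> kernel (GK m H K) (restrict_to (aut_tree m) K) f \<subseteq> center (GK m H K)))) \<and>
    restrict_to (GK m H K) (center (GK m H K)) \<cong>
      restrict_to (sym_group m) (center (restrict_to (sym_group m) H))"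
proof -
  have sub: "subgroup K (aut_tree m)"
    using assms(6) unfolding branch_def by (rule conjunct1)
  interpret rooted_diagonal m H K
    using assms(1,2) sub by (intro rooted_diagonal.intro) auto
  interpret group_hom "GK m H K" "restrict_to (aut_tree m) (diag_subgroup m K)" diag_part
    by (rule diag_part_hom)
  \<comment> \<open>This is the map that the first isomorphism theorem attaches to
    \<open>diag_part\<close>.\<close>
  define \<theta> where "\<theta> X = the_elem (diag_part ` X)" for X
  have \<theta>_coset: "\<theta> (rooted m H #>\<^bsub>GK m H K\<^esub> g) = diag_part g" if "g \<in> carrier (GK m H K)" for g
    using that by (simp add: \<theta>_def diag_part_coset)
  have Z: "z = id" if "z \<in> K" "\<And>k. k \<in> K \<Longrightarrow> z \<circ> k = k \<circ> z" for z
    using branch_center_trivial[OF assms(1,6)] that by blast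
  have wreath: "subgroup (carrier (GK m H K)) (restrict_to (aut_tree m) (wreath m H))"
    using aut.subgroup_incl[OF subgroup_GK subgroup_wreath[OF H]]
      GK_subset_wreath subgroup.subset[OF assms(4)] by simp
  have normal: "rooted m H \<lhd> GK m H K"
    using normal_kernel by (simp only: kernel_diag_part)
  have iso: "\<theta> \<in> iso (GK m H K Mod rooted m H) (restrict_to (aut_tree m) (diag_subgroup m K))"
    using FactGroup_iso_set diag_part_surj by (simp add: kernel_diag_part \<theta>_def[abs_def])
  \<comment> \<open>\<open>diag_part\<close> is a retraction: it restricts to the identity on
    D_m(K).\<close>
  have diag: "\<theta> (rooted m H #>\<^bsub>GK m H K\<^esub> d) = d" if "d \<in> diag_subgroup m K" for d
    using that prod_act_in_GK[OF H_id] by (auto simp: diag_image \<theta>_coset)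
  have action: "let \<pi> = (\<lambda>g. \<theta> (rooted m H #>\<^bsub>GK m H K\<^esub> g));
            \<phi> = (\<lambda>g. tree_section g v);
            f = \<phi> \<circ> \<pi>
        in f \<in> hom (GK m H K) (restrict_to (aut_tree m) K) \<and>
           f \<in> hom (GK m H K) (aut_tree m) \<and>
           f ` carrier (GK m H K) = K \<and>
           kernel (GK m H K) (restrict_to (aut_tree m) K) f = rooted m H \<and>
           branch m (f ` carrier (GK m H K)) \<and>
           (\<not> comm_group (restrict_to (sym_group m) H) \<longrightarrow>
             \<not> kernel (GK m H K) (restrict_to (aut_tree m) K) f \<subseteq> center (GK m H K))"
    if v: "v \<in> level m 1" for v
  proof -
    define f where "f = (\<lambda>g. tree_section g v) \<circ> (\<lambda>g. \<theta> (rooted m H #>\<^bsub>GK m H K\<^esub> g))"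
    have f: "f g = tree_section (diag_part g) v" if "g \<in> carrier (GK m H K)" for g
      using that by (simp add: f_def \<theta>_coset)
    \<comment> \<open>The formula for \<open>f\<close> through \<open>diag_part\<close> holds on the
      carrier, so the facts on the level 1 action are transferred by congruence there.\<close>
    have hom: "f \<in> hom (GK m H K) (restrict_to (aut_tree m) K)"
      using group.hom_eq[OF group_GK level_one_action(1)[OF v]] f by blast
    moreover have "f \<in> hom (GK m H K) (aut_tree m)"
      using hom K_carrier by (auto simp: hom_def Pi_iff)
    moreover have "f ` carrier (GK m H K) = K"
      using level_one_action(2)[OF v] f by (metis (no_types, lifting) image_cong)
    moreover have "kernel (GK m H K) (restrict_to (aut_tree m) K) f = rooted m H"
      using level_one_action(3)[OF v] f by (simp add: kernel_def cong: conj_cong)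
    ultimately show ?thesis
      using assms(6) comm_group_if_rooted_central unfolding Let_def f_def[symmetric] by auto
  qed
  have "restrict_to (GK m H K) (center (GK m H K)) \<cong>
      restrict_to (sym_group m) (center (restrict_to (sym_group m) H))"
    using Z by (rule center_GK_iso)
  then show ?thesis
    using wreath normal iso diag action by blast
qed

end
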